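(* For every integer $t\geq 2$ there exists a set $D\subseteq(0,\infty)$ with $0<|D|<\infty$ such that $\chi_m(G(\mathbb{R},D))>\chi(G(\mathbb{R},D))=t$.
   Context: We work in ZFC (the Axiom of Choice is assumed). For a set $D\subseteq(0,\infty)$ with $0<|D|<\infty$, the distance graph $G(\mathbb{R},D)$ has vertex set $\mathbb{R}$, with distinct $x,y$ adjacent if and only if $|x-y|\in D$. A coloring is proper if adjacent vertices receive different colors, and $\chi(G(\mathbb{R},D))$ is the least number of colors in a proper coloring of $G(\mathbb{R},D)$. A coloring $\varphi:\mathbb{R}\to\{C_0,\dots,C_{t-1}\}$ is a slab coloring if for each $j$ the color class $\varphi^{-1}(C_j)$ is a union of intervals, where intervals are nondegenerate (of positive length). $\chi_m(G(\mathbb{R},D))$ denotes the least number of colors in a proper slab coloring of $G(\mathbb{R},D)$. *)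

theory Defs
  imports "HOL-Analysis.Analysis"
begin

definition distance_adj :: "real set \<Rightarrow> real \<Rightarrow> real \<Rightarrow> bool" where
  "distance_adj D x y \<longleftrightarrow> x \<noteq> y \<and> \<bar>x - y\<bar> \<in> D"

definition coloring :: "nat \<Rightarrow> ('a \<Rightarrow> nat) \<Rightarrow> bool" where
  "coloring t \<phi> \<longleftrightarrow> (\<forall>x. \<phi> x < t)"

definition proper :: "('a \<Rightarrow> 'a \<Rightarrow> bool) \<Rightarrow> ('a \<Rightarrow> nat) \<Rightarrow> bool" where
  "proper adj \<phi> \<longleftrightarrow> (\<forall>x y. adj x y \<longrightarrow> \<phi> x \<noteq> \<phi> y)"

definition nondegenerate_interval :: "real set \<Rightarrow> bool" where
  "nondegenerate_interval S \<longleftrightarrow> is_interval S \<and> (\<exists>a\<in>S. \<exists>b\<in>S. a < b)"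

definition slab_coloring :: "nat \<Rightarrow> (real \<Rightarrow> nat) \<Rightarrow> bool" where
  "slab_coloring t \<phi> \<longleftrightarrow> coloring t \<phi> \<and>
     (\<forall>j<t. \<exists>\<I>. (\<forall>S\<in>\<I>. nondegenerate_interval S) \<and> \<phi> -` {j} = \<Union>\<I>)"

text \<open>
  The following two numbers are only meaningful when some finite number of colors suffices;
  by \<open>ex_proper_slab_coloring\<close> below this holds for every finite nonempty set of
  positive distances.
\<close>

definition chi :: "real set \<Rightarrow> nat" where
  "chi D = (LEAST t. \<exists>\<phi>. coloring t \<phi> \<and> proper (distance_adj D) \<phi>)"

definition chi_m :: "real set \<Rightarrow> nat" where
  "chi_m D = (LEAST t. \<exists>\<phi>. slab_coloring t \<phi> \<and> proper (distance_adj D) \<phi>)"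

lemma ex_proper_slab_coloring:
  assumes D: "D \<subseteq> {0<..}" "finite D" "D \<noteq> {}"
  shows "\<exists>t \<phi>. slab_coloring t \<phi> \<and> proper (distance_adj D) \<phi>"
proof -
  define m where "m = Min D"
  have m: "m > 0" "\<And>d. d \<in> D \<Longrightarrow> m \<le> d"
    using D Min_in[of D] unfolding m_def by auto
  obtain N :: nat where N: "Max D / m + 1 < real N"
    using reals_Archimedean2 by blast
  have Max0: "0 < Max D" using D Max_in[of D] by (meson greaterThan_iff subsetD)
  have Npos: "N > 0" using N m(1) Max0 by (intro Nat.gr0I) (auto simp: field_simps)
  define \<phi> where "\<phi> x = nat (\<lfloor>x / m\<rfloor> mod int N)" for x :: real
  have range: "\<phi> x < N" for x
    using Npos unfolding \<phi>_def by (simp add: nat_less_iff)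
  define J where "J k = {x::real. \<lfloor>x / m\<rfloor> = k}" for k :: int
  have J_eq: "J k = {of_int k * m ..< (of_int k + 1) * m}" for k
    using m(1) unfolding J_def by (auto simp: floor_eq_iff field_simps)
  have J: "nondegenerate_interval (J k)" for k
  proof -
    have "of_int k * m \<in> J k" "of_int k * m + m / 2 \<in> J k"
      using m(1) unfolding J_eq by (auto simp: algebra_simps)
    moreover have "of_int k * m < of_int k * m + m / 2" using m(1) by simp
    moreover have "is_interval (J k)" unfolding J_eq by (rule is_interval_co)
    ultimately show ?thesis unfolding nondegenerate_interval_def by blast
  qed
  have "slab_coloring N \<phi>"
    unfolding slab_coloring_def coloring_def
  proof (intro conjI allI impI)
    fix j assume "j < N"
    have "\<phi> -` {j} = \<Union>(J ` {k. nat (k mod int N) = j})"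
      unfolding \<phi>_def J_def by auto
    with J show "\<exists>\<I>. (\<forall>S\<in>\<I>. nondegenerate_interval S) \<and> \<phi> -` {j} = \<Union>\<I>"
      by (intro exI[of _ "J ` {k. nat (k mod int N) = j}"]) auto
  qed (rule range)
  moreover have "\<phi> x \<noteq> \<phi> y" if "x < y" "y - x \<in> D" for x y
  proof
    assume eq: "\<phi> x = \<phi> y"
    define a b where "a = \<lfloor>x / m\<rfloor>" and "b = \<lfloor>y / m\<rfloor>"
    have "a mod int N = b mod int N"
      using eq Npos unfolding \<phi>_def a_def b_def by (simp add: eq_nat_nat_iff)
    then have "int N dvd b - a" by (metis mod_eq_dvd_iff)
    moreover have "(x + m) / m \<le> y / m"
      using m(2)[OF that(2)] m(1) by (intro divide_right_mono) auto
    then have "x / m + 1 \<le> y / m" using m(1) by (simp add: add_divide_distrib)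
    then have "a < b" unfolding a_def b_def by linarith
    ultimately have "int N \<le> b - a" by (simp add: zdvd_imp_le)
    then have "real N \<le> of_int b - of_int a" by linarith
    moreover have "of_int b - of_int a < y / m - x / m + 1"
      unfolding a_def b_def by linarith
    moreover have "y / m - x / m \<le> Max D / m"
      using D that m(1) by (simp add: diff_divide_distrib[symmetric] divide_right_mono)
    ultimately show False using N by linarith
  qed
  then have "proper (distance_adj D) \<phi>"
    unfolding proper_def distance_adj_def
    by (metis abs_minus_commute abs_of_pos diff_gt_0_iff_gt linorder_neqE_linordered_idom)
  ultimately show ?thesis by blast
qed

end

theory Submission imports Defs begin

text \<open>
  Take the distances \<open>1, \<dots>, t - 1\<close> and \<open>\<alpha>, \<dots>, (t - 1) \<alpha>\<close> with \<open>\<alpha>\<close> irrational. Each component of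
  the graph is a coset of \<open>\<int> + \<int>\<alpha>\<close>, on which \<open>m + n \<alpha> \<mapsto> m + n mod t\<close> is proper; choosing a base
  point in every coset gives a proper coloring with \<open>t\<close> colors. Conversely, any \<open>t\<close> consecutive
  multiples of a generator form a clique, so every proper coloring with \<open>t\<close> colors has the periods
  \<open>t\<close> and \<open>t \<alpha>\<close>, hence arbitrarily small periods. A color that is constant on an interval is then
  constant everywhere.
\<close>

section \<open>Cliques of multiples and the periods they force\<close>

definition multiples_below :: "nat \<Rightarrow> real \<Rightarrow> real set" where
  "multiples_below t d = (\<lambda>k. real k * d) ` {1..<t}"

text \<open>The gap \<open>(j - i) * d\<close> is one of the distances in
  \<open>multiples_below t d\<close>, so any \<open>t\<close> consecutive terms of the progression
  \<open>x + i * d\<close> form a clique.\<close>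

lemma proper_multiples_neq:
  assumes pr: "proper (distance_adj D) \<phi>" and sub: "multiples_below t d \<subseteq> D"
    and d: "d > 0" and ij: "i < j" "j < i + t"
  shows "\<phi> (x + real i * d) \<noteq> \<phi> (x + real j * d)"
proof -
  have eq: "\<bar>(x + real i * d) - (x + real j * d)\<bar> = real (j - i) * d"
  proof -
    have "(x + real i * d) - (x + real j * d) = - (real (j - i) * d)"
      using ij by (simp add: algebra_simps)
    then show ?thesis using d by (simp only: abs_minus_cancel) simp
  qed
  have "j - i \<in> {1..<t}" using ij by auto
  then have "real (j - i) * d \<in> D"
    using sub unfolding multiples_below_def by blast
  moreover have "x + real i * d \<noteq> x + real j * d"
    using d ij by simp
  ultimately show ?thesis
    using pr eq unfolding proper_def distance_adj_def by metis
qed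

text \<open>Pigeonhole on the clique 0, \<open>d\<close>, ..., \<open>(t - 1) * d\<close>; this is
  the lower bound for \<open>chi\<close>.\<close>

lemma proper_multiples_color_count:
  assumes "coloring s \<phi>" "proper (distance_adj D) \<phi>" "multiples_below t d \<subseteq> D" "d > 0"
  shows "t \<le> s"
proof -
  have "inj_on (\<lambda>i. \<phi> (0 + real i * d)) {..<t}"
    by (rule linorder_inj_onI', rule proper_multiples_neq[OF assms(2-4)]) auto
  moreover have "(\<lambda>i. \<phi> (0 + real i * d)) ` {..<t} \<subseteq> {..<s}"
    using assms(1) unfolding coloring_def by auto
  ultimately show ?thesis
    by (metis card_inj_on_le card_lessThan finite_lessThan)
qed

text \<open>The \<open>t - 1\<close> progression points strictly between \<open>x\<close> and
  \<open>x + t * d\<close> use distinct colors, and both ends are adjacent to all of them. With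
  exactly \<open>t\<close> colors, one color is left for both ends.\<close>

lemma proper_multiples_periodic:
  assumes col: "coloring t \<phi>" and pr: "proper (distance_adj D) \<phi>"
    and sub: "multiples_below t d \<subseteq> D" and d: "d > 0"
  shows "\<phi> (x + real t * d) = \<phi> x"
proof -
  note neq = proper_multiples_neq[OF pr sub d, where x = x]
  define S where "S = (\<lambda>i. \<phi> (x + real i * d)) ` {1..<t}"
  have t: "t > 0" using col unfolding coloring_def by (metis gr_zeroI not_less0)
  have "inj_on (\<lambda>i. \<phi> (x + real i * d)) {1..<t}"
    by (rule linorder_inj_onI', rule neq) auto
  then have "card S = t - 1" unfolding S_def by (simp add: card_image)
  moreover have "S \<subseteq> {..<t}" using col unfolding S_def coloring_def by auto
  ultimately have "card ({..<t} - S) = 1"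
    using t by (simp add: card_Diff_subset finite_subset)
  moreover have "\<phi> x \<noteq> \<phi> (x + real i * d)" if "i \<in> {1..<t}" for i
    using neq[of 0 i] that by simp
  then have "\<phi> x \<in> {..<t} - S"
    using col unfolding S_def coloring_def by blast
  moreover have "\<phi> (x + real t * d) \<noteq> \<phi> (x + real i * d)" if "i \<in> {1..<t}" for i
    using neq[of i t] that by simp
  then have "\<phi> (x + real t * d) \<in> {..<t} - S"
    using col unfolding S_def coloring_def by blast
  ultimately show ?thesis by (metis card_1_singletonE singletonD)
qed

section \<open>Arbitrarily small periods\<close>

lemma int_multiple_period:
  fixes \<phi> :: "real \<Rightarrow> 'a"
  assumes p: "\<And>x. \<phi> (x + p) = \<phi> x"
  shows "\<phi> (x + of_int m * p) = \<phi> x"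
proof -
  have nat: "\<phi> (y + real n * p) = \<phi> y" for y n
  proof (induction n)
    case (Suc n)
    then show ?case using p[of "y + real n * p"] by (simp add: algebra_simps)
  qed simp
  show ?thesis
  proof (cases m rule: int_cases2)
    case (nonneg n)
    then show ?thesis using nat by simp
  next
    case (nonpos n)
    then show ?thesis using nat[of "x - real n * p" n] by simp
  qed
qed

text \<open>Every \<open>y\<close> can be moved by a multiple of \<open>p\<close> into
  \<open>[a, a + p)\<close>, which lies inside \<open>[a, b]\<close>.\<close>

lemma small_period_constant:
  fixes \<phi> :: "real \<Rightarrow> 'a"
  assumes p: "\<And>x. \<phi> (x + p) = \<phi> x" and "p > 0" "a + p \<le> b"
    and const: "\<And>x. x \<in> {a..b} \<Longrightarrow> \<phi> x = c"
  shows "\<phi> y = c"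
proof -
  define k where "k = \<lfloor>(y - a) / p\<rfloor>"
  have "of_int k \<le> (y - a) / p" "(y - a) / p < of_int k + 1"
    unfolding k_def by linarith+
  then have "y + of_int (- k) * p \<in> {a..b}"
    using assms(2,3) by (simp add: field_simps)
  then have "\<phi> (y + of_int (- k) * p) = c" by (rule const)
  then show ?thesis by (simp only: int_multiple_period[where \<phi> = \<phi>, OF p])
qed

lemma incommensurable_small_period:
  fixes \<phi> :: "real \<Rightarrow> 'a" and \<alpha> :: real
  assumes p: "\<And>x. \<phi> (x + s) = \<phi> x" and q: "\<And>x. \<phi> (x + s * \<alpha>) = \<phi> x"
    and s: "s > 0" and irr: "\<alpha> \<notin> \<rat>" and e: "e > 0"
  obtains r where "0 < r" "r < e" "\<And>x. \<phi> (x + r) = \<phi> x"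
proof -
  \<comment> \<open>Dirichlet's theorem will bound the error by \<open>1 / N\<close>; this choice of
    \<open>N\<close> keeps it below \<open>e\<close> after scaling by \<open>s\<close>.\<close>
  obtain N :: nat where N: "s / e < real N"
    using reals_Archimedean2 by blast
  moreover have "0 < s / e" using s e by simp
  ultimately have "0 < real N" by linarith
  then have "N > 0" by simp
  obtain h k where hk: "0 < k" "k \<le> int N" "\<bar>of_int k * \<alpha> - of_int h\<bar> < 1 / real N"
    using Dirichlet_approx[OF \<open>N > 0\<close>, of \<alpha>] by blast
  define u where "u = s * (of_int k * \<alpha> - of_int h)"
  have "\<phi> (x + u) = \<phi> x" for x
  proof -
    have "x + u = (x + of_int k * (s * \<alpha>)) + of_int (- h) * s"
      unfolding u_def by (simp add: algebra_simps)
    then show ?thesis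
      by (simp only: int_multiple_period[where \<phi> = \<phi>, OF p] int_multiple_period[where \<phi> = \<phi>, OF q])
  qed
  moreover from this[of "x - u" for x] have "\<phi> (x - u) = \<phi> x" for x by simp
  \<comment> \<open>The approximation error may have either sign, so the absolute value is taken as
    the period.\<close>
  ultimately have per: "\<phi> (x + \<bar>u\<bar>) = \<phi> x" for x by (cases "u \<ge> 0") auto
  \<comment> \<open>Irrationality enters here: it keeps the small period from being zero.\<close>
  have "of_int k * \<alpha> - of_int h \<noteq> 0"
  proof
    assume "of_int k * \<alpha> - of_int h = 0"
    then have "\<alpha> = of_int h / of_int k" using hk(1) by (simp add: field_simps)
    then show False using irr by simp
  qed
  then have "\<bar>u\<bar> > 0" using s unfolding u_def by simp
  moreover have "\<bar>u\<bar> < e"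
  proof -
    have "\<bar>u\<bar> < s * (1 / real N)"
      unfolding u_def abs_mult using s hk(3) by (simp del: times_divide_eq_right)
    also have "\<dots> < e" using N e \<open>N > 0\<close> by (simp add: field_simps)
    finally show ?thesis .
  qed
  ultimately show thesis using per that by blast
qed

section \<open>A proper coloring with \<open>t\<close> colors\<close>

lemma int_combination_unique:
  fixes \<alpha> :: real
  assumes "\<alpha> \<notin> \<rat>" "of_int m + of_int n * \<alpha> = of_int m' + of_int n' * \<alpha>"
  shows "m = m' \<and> n = n'"
proof -
  have "n = n'"
  proof (rule ccontr)
    assume "n \<noteq> n'"
    then have "\<alpha> = of_int (m' - m) / of_int (n - n')"
      using assms(2) by (simp add: field_simps)
    then show False using assms(1) by (metis Rats_divide Rats_of_int)
  qed
  then show ?thesis using assms(2) by simp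
qed

text \<open>Relative to a base point chosen in its coset of \<open>L\<close>, the group of all
  \<open>m + n * \<alpha>\<close>, each real has integer coordinates; the height is their
  sum.\<close>

lemma ex_additive_height:
  fixes \<alpha> :: real
  assumes irr: "\<alpha> \<notin> \<rat>"
  obtains f :: "real \<Rightarrow> int" where "\<And>x m n. f (x + of_int m + of_int n * \<alpha>) = f x + m + n"
proof -
  define L where "L = {of_int m + of_int n * \<alpha> | m n. True}"
  define base where "base x = (SOME y. x - y \<in> L)" for x
  have L0: "0 \<in> L" unfolding L_def by (force intro: exI[of _ 0])
  have L_add: "u + v \<in> L" if uv: "u \<in> L" "v \<in> L" for u v
  proof -
    obtain a b c d where "u = of_int a + of_int b * \<alpha>" "v = of_int c + of_int d * \<alpha>"
      using uv unfolding L_def by blast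
    then have "u + v = of_int (a + c) + of_int (b + d) * \<alpha>" by (simp add: algebra_simps)
    then show ?thesis unfolding L_def by blast
  qed
  have base_L: "x - base x \<in> L" for x
    unfolding base_def by (rule someI[of _ x]) (simp add: L0)
  have base_eq: "base (x + of_int m + of_int n * \<alpha>) = base x" for x m n
  proof -
    have v: "of_int m + of_int n * \<alpha> \<in> L" "of_int (- m) + of_int (- n) * \<alpha> \<in> L"
      unfolding L_def by blast+
    \<comment> \<open>Both points have the same candidates \<open>y\<close>, so \<open>SOME\<close>
      returns the same base point for the whole coset.\<close>
    have "x + of_int m + of_int n * \<alpha> - y \<in> L \<longleftrightarrow> x - y \<in> L" for y
      using L_add[OF _ v(1), of "x - y"] L_add[OF _ v(2), of "x + of_int m + of_int n * \<alpha> - y"]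
      by (auto simp: algebra_simps)
    then show ?thesis unfolding base_def by simp
  qed
  have "\<forall>x. \<exists>m n. x - base x = of_int m + of_int n * \<alpha>"
    using base_L unfolding L_def by blast
  then obtain M N where MN: "\<And>x. x - base x = of_int (M x) + of_int (N x) * \<alpha>"
    by metis
  have "M (x + of_int m + of_int n * \<alpha>) + N (x + of_int m + of_int n * \<alpha>) = M x + N x + m + n"
    for x m n
  proof -
    define y where "y = x + of_int m + of_int n * \<alpha>"
    have "base y = base x" unfolding y_def by (rule base_eq)
    then have "of_int (M y) + of_int (N y) * \<alpha> = y - base x"
      using MN[of y] by simp
    also have "\<dots> = of_int (M x + m) + of_int (N x + n) * \<alpha>"
      using MN[of x] by (simp add: y_def algebra_simps)
    finally show ?thesis using int_combination_unique[OF irr] unfolding y_def by fastforce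
  qed
  then show thesis by (rule that[of "\<lambda>x. M x + N x"])
qed

text \<open>A step by \<open>k\<close> or by \<open>k * \<alpha>\<close> with
  \<open>1 \<le> k < t\<close> raises the height by \<open>k\<close>, which is nonzero modulo
  \<open>t\<close>.\<close>

lemma ex_proper_coloring_multiples:
  assumes t: "t \<ge> 1" and irr: "\<alpha> \<notin> \<rat>"
  shows "\<exists>\<phi>. coloring t \<phi> \<and> proper (distance_adj (multiples_below t 1 \<union> multiples_below t \<alpha>)) \<phi>"
proof -
  obtain f :: "real \<Rightarrow> int" where
    f: "\<And>x m n. f (x + of_int m + of_int n * \<alpha>) = f x + m + n"
    using ex_additive_height[OF irr] by metis
  define \<phi> where "\<phi> x = nat (f x mod int t)" for x
  have step: "\<phi> y \<noteq> \<phi> x" if diff: "y - x \<in> multiples_below t 1 \<union> multiples_below t \<alpha>" for x y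
  proof -
    obtain k where k: "1 \<le> k" "k < t" "y = x + real k \<or> y = x + real k * \<alpha>"
      using diff unfolding multiples_below_def by (auto simp: algebra_simps)
    then have fy: "f y = f x + int k"
      using f[of x "int k" 0] f[of x 0 "int k"] by auto
    show ?thesis
    proof
      assume "\<phi> y = \<phi> x"
      then have "f y mod int t = f x mod int t"
        using t unfolding \<phi>_def by (simp add: eq_nat_nat_iff)
      then have "int t dvd int k" using fy by (metis add_diff_cancel_left' mod_eq_dvd_iff)
      then show False using k by (simp add: nat_dvd_not_less)
    qed
  qed
  have "proper (distance_adj (multiples_below t 1 \<union> multiples_below t \<alpha>)) \<phi>"
    unfolding proper_def distance_adj_def
  proof (intro allI impI)
    fix x y assume "x \<noteq> y \<and> \<bar>x - y\<bar> \<in> multiples_below t 1 \<union> multiples_below t \<alpha>"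
    then show "\<phi> x \<noteq> \<phi> y" using step[of x y] step[of y x] by (cases "x \<ge> y") auto
  qed
  moreover have "coloring t \<phi>"
    using t unfolding coloring_def \<phi>_def by (simp add: nat_less_iff)
  ultimately show ?thesis by blast
qed

section \<open>Slab colorings need more than \<open>t\<close> colors\<close>

lemma slab_coloring_constant_on_interval:
  assumes "slab_coloring t \<phi>"
  obtains a b c where "a < b" "\<And>x. x \<in> {a..b} \<Longrightarrow> \<phi> x = c"
proof -
  have "\<phi> 0 < t" using assms unfolding slab_coloring_def coloring_def by blast
  then obtain \<I> where I: "\<forall>S\<in>\<I>. nondegenerate_interval S" "\<phi> -` {\<phi> 0} = \<Union>\<I>"
    using assms unfolding slab_coloring_def by blast
  \<comment> \<open>The class of the color of 0 contains 0, so its family of intervals is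
    nonempty.\<close>
  then obtain S where S: "S \<in> \<I>" by blast
  then obtain a b where ab: "a \<in> S" "b \<in> S" "a < b" "is_interval S"
    using I(1) unfolding nondegenerate_interval_def by blast
  have "\<phi> x = \<phi> 0" if "x \<in> {a..b}" for x
  proof -
    have "x \<in> S" using mem_is_interval_1_I[OF ab(4,1,2)] that by simp
    then show ?thesis using S I(2) by blast
  qed
  with ab show thesis using that by blast
qed

text \<open>Some period is shorter than an interval of constant color, so the whole coloring is
  constant, which contradicts the edge between 0 and 1. All \<open>s \<le> t\<close> are covered
  because \<open>chi_m\<close> is a least number.\<close>

lemma no_proper_slab_coloring_multiples:
  assumes t: "t \<ge> 2" and \<alpha>: "\<alpha> > 0" "\<alpha> \<notin> \<rat>" and D: "D = multiples_below t 1 \<union> multiples_below t \<alpha>"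
    and s: "s \<le> t"
  shows "\<not> (slab_coloring s \<phi> \<and> proper (distance_adj D) \<phi>)"
proof
  assume "slab_coloring s \<phi> \<and> proper (distance_adj D) \<phi>"
  then have slab: "slab_coloring s \<phi>" and pr: "proper (distance_adj D) \<phi>" by auto
  \<comment> \<open>The palette is enlarged to \<open>t\<close> colors, the number for which
    \<open>proper_multiples_periodic\<close> is stated.\<close>
  have col: "coloring t \<phi>"
    using slab s unfolding slab_coloring_def coloring_def by (meson less_le_trans)
  obtain a b c where ab: "a < b" "\<And>x. x \<in> {a..b} \<Longrightarrow> \<phi> x = c"
    using slab_coloring_constant_on_interval[OF slab] by blast
  have "\<phi> (x + real t) = \<phi> x" for x
    using proper_multiples_periodic[OF col pr, of 1] D by simp
  moreover have "\<phi> (x + real t * \<alpha>) = \<phi> x" for x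
    using proper_multiples_periodic[OF col pr, of \<alpha>] D \<alpha> by simp
  moreover have "real t > 0" "b - a > 0" using t ab(1) by simp_all
  ultimately obtain r where r: "0 < r" "r < b - a" "\<And>x. \<phi> (x + r) = \<phi> x"
    using incommensurable_small_period[of \<phi> "real t" \<alpha> "b - a"] \<alpha>(2) by metis
  have const: "\<phi> y = c" for y
    by (rule small_period_constant[where \<phi> = \<phi> and a = a and b = b, OF r(3,1) _ ab(2)])
      (use r(2) in auto)
  have "\<phi> (0 + real 0 * 1) \<noteq> \<phi> (0 + real 1 * 1)"
    by (rule proper_multiples_neq[OF pr, of t]) (use t D in auto)
  then show False using const by simp
qed

theorem theorem1:
  fixes t :: nat
  assumes "t \<ge> 2"
  shows "\<exists>D :: real set. D \<subseteq> {0<..} \<and> finite D \<and> 0 < card D \<and>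
           chi_m D > chi D \<and> chi D = t"
proof -
  have "uncountable ({0<..<1} - \<rat> :: real set)"
    by (intro uncountable_minus_countable countable_rat) (simp add: uncountable_open_interval)
  then obtain \<alpha> :: real where \<alpha>: "\<alpha> > 0" "\<alpha> \<notin> \<rat>"
    by (metis Diff_iff countable_empty equals0I greaterThanLessThan_iff)
  define D where "D = multiples_below t 1 \<union> multiples_below t \<alpha>"
  have pos: "D \<subseteq> {0<..}" and fin: "finite D" and ne: "D \<noteq> {}"
    using \<alpha> assms unfolding D_def multiples_below_def by auto
  have chi: "chi D = t"
    unfolding chi_def
  proof (rule Least_equality)
    show "\<exists>\<phi>. coloring t \<phi> \<and> proper (distance_adj D) \<phi>"
      using ex_proper_coloring_multiples[of t \<alpha>] assms \<alpha> unfolding D_def by simp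
    show "t \<le> s" if "\<exists>\<phi>. coloring s \<phi> \<and> proper (distance_adj D) \<phi>" for s
      using that proper_multiples_color_count[of s _ D t 1] unfolding D_def by auto
  qed
  \<comment> \<open>The least number is attained because a proper slab coloring with finitely many
    colors exists.\<close>
  have "\<exists>\<phi>. slab_coloring (chi_m D) \<phi> \<and> proper (distance_adj D) \<phi>"
    unfolding chi_m_def by (rule LeastI_ex) (rule ex_proper_slab_coloring[OF pos fin ne])
  then have "chi_m D > t"
    using no_proper_slab_coloring_multiples[OF assms \<alpha> D_def] by (metis not_le_imp_less)
  then show ?thesis using pos fin ne chi by (intro exI[of _ D]) (simp add: card_gt_0_iff)
qed

end
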